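(* $\mathfrak{g} \leq \mathfrak{b}^+$, where $\mathfrak{g}$ is the groupwise density number, $\mathfrak{b}$ is the unbounded number, and $\mathfrak{b}^+$ denotes the cardinal successor of $\mathfrak{b}$.
   Context: For $f,g \in {}^\omega\omega$, write $f \leq_{J^{\rm bd}_\omega} g$ iff there is $N<\omega$ with $f(n)\leq g(n)$ for all $n>N$. The unbounded number is $\mathfrak{b}=\min\{|\mathcal{F}| : \mathcal{F}\subseteq {}^\omega\omega \text{ has no } \leq_{J^{\rm bd}_\omega}\text{-upper bound in } {}^\omega\omega\}$. For infinite $A,B\subseteq\omega$, $B\subseteq^* A$ means $B\setminus A$ is finite; $[\omega]^{\aleph_0}$ is the set of infinite subsets of $\omega$. A family $\mathcal{A}\subseteq[\omega]^{\aleph_0}$ is groupwise dense if (i) whenever $B\subseteq A\in\mathcal{A}$ and $B\in[\omega]^{\aleph_0}$ then $B\in\mathcal{A}$, and (ii) for every strictly increasing sequence $\langle m_i : i<\omega\rangle\in{}^\omega\omega$ there is an infinite $\mathcal{U}\subseteq\omega$ with $\bigcup\{[m_i,m_{i+1}) : i\in\mathcal{U}\}\in\mathcal{A}$. The groupwise density number $\mathfrak{g}$ is the minimal cardinal $\theta$ for which there is a sequence $\langle\mathcal{A}_\alpha:\alpha<\theta\rangle$ of groupwise dense subsets of $[\omega]^{\aleph_0}$ such that for every $B\in[\omega]^{\aleph_0}$ there is $\alpha<\theta$ with $B\not\subseteq^* A$ for all $A\in\mathcal{A}_\alpha$. *)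

theory Defs
  imports Main
begin

unbundle cardinal_syntax

text \<open>
  Cardinals are those of the library: well-orders \<open>r\<close> with \<open>Card_order r\<close>, compared by
  \<open>\<le>o\<close> (which relates cardinals on different types); \<open>cardSuc\<close> is the cardinal successor.
  As for \<open>cardSuc\<close>, a minimum of a class of cardinals is picked by \<open>SOME\<close>, and is unique up to
  \<open>=o\<close>. An index \<open>\<alpha> < \<theta>\<close> of a sequence of length a cardinal \<open>r\<close> is an element of \<open>Field r\<close>.
\<close>

definition le_Jbd :: "(nat \<Rightarrow> nat) \<Rightarrow> (nat \<Rightarrow> nat) \<Rightarrow> bool" where
  "le_Jbd f g \<longleftrightarrow> (\<exists>N. \<forall>n>N. f n \<le> g n)"

definition unbounded_family :: "(nat \<Rightarrow> nat) set \<Rightarrow> bool" where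
  "unbounded_family F \<longleftrightarrow> \<not> (\<exists>g. \<forall>f\<in>F. le_Jbd f g)"

definition is_unbounded_number :: "(nat \<Rightarrow> nat) rel \<Rightarrow> bool" where
  "is_unbounded_number r \<longleftrightarrow>
     (\<exists>F. unbounded_family F \<and> r = |F| ) \<and> (\<forall>F. unbounded_family F \<longrightarrow> r \<le>o |F| )"

definition unbounded_number :: "(nat \<Rightarrow> nat) rel"  (\<open>\<bb>\<close>) where
  "\<bb> = (SOME r. is_unbounded_number r)"

definition almost_subset :: "nat set \<Rightarrow> nat set \<Rightarrow> bool"  (infix \<open>\<subseteq>*\<close> 50) where
  "B \<subseteq>* A \<longleftrightarrow> finite (B - A)"

definition groupwise_dense :: "nat set set \<Rightarrow> bool" where
  "groupwise_dense \<A> \<longleftrightarrow>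
     \<A> \<subseteq> {A. infinite A} \<and>
     (\<forall>A B. A \<in> \<A> \<and> B \<subseteq> A \<and> infinite B \<longrightarrow> B \<in> \<A>) \<and>
     (\<forall>m :: nat \<Rightarrow> nat. strict_mono m \<longrightarrow>
        (\<exists>U. infinite U \<and> (\<Union>i\<in>U. {m i..<m (Suc i)}) \<in> \<A>))"

definition groupwise_density_witness :: "'a rel \<Rightarrow> ('a \<Rightarrow> nat set set) \<Rightarrow> bool" where
  "groupwise_density_witness r \<A> \<longleftrightarrow>
     (\<forall>\<alpha>\<in>Field r. groupwise_dense (\<A> \<alpha>)) \<and>
     (\<forall>B. infinite B \<longrightarrow> (\<exists>\<alpha>\<in>Field r. \<forall>A\<in>\<A> \<alpha>. \<not> B \<subseteq>* A))"

text \<open>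
  Minimality among cardinals on the type of \<open>r\<close> is minimality among all cardinals, see
  \<open>groupwise_density_number_le\<close> below.
\<close>

definition is_groupwise_density_number :: "'a rel \<Rightarrow> bool" where
  "is_groupwise_density_number r \<longleftrightarrow>
     Card_order r \<and> (\<exists>\<A>. groupwise_density_witness r \<A>) \<and>
     (\<forall>r' :: 'a rel. Card_order r' \<and> (\<exists>\<A>. groupwise_density_witness r' \<A>) \<longrightarrow> r \<le>o r')"

text \<open>
  There is a witness of length continuum (\<open>groupwise_density_witness_exists\<close>), so the type
  \<open>nat set\<close> is large enough to carry the groupwise density number.
\<close>

definition groupwise_density_number :: "nat set rel"  (\<open>\<gg>\<close>) where
  "\<gg> = (SOME r. is_groupwise_density_number r)"


subsection \<open>The two numbers are well defined\<close>

lemma unbounded_family_UNIV: "unbounded_family UNIV"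
  unfolding unbounded_family_def le_Jbd_def
proof
  assume "\<exists>g::nat\<Rightarrow>nat. \<forall>f\<in>UNIV. \<exists>N. \<forall>n>N. f n \<le> g n"
  then obtain g :: "nat \<Rightarrow> nat" where g: "\<And>f. \<exists>N. \<forall>n>N. f n \<le> g n"
    by blast
  from g[of "\<lambda>n. Suc (g n)"] obtain N where "\<forall>n>N. Suc (g n) \<le> g n"
    by blast
  from this[rule_format, of "Suc N"] show False
    by simp
qed

lemma is_unbounded_number_unbounded_number: "is_unbounded_number \<bb>"
proof -
  let ?R = "{|F| | F. unbounded_family F}"
  have "?R \<noteq> {}"
    using unbounded_family_UNIV by blast
  moreover have "\<forall>r\<in>?R. Card_order r"
    using card_of_Card_order by blast
  ultimately obtain r where "r \<in> ?R" "\<forall>r'\<in>?R. r \<le>o r'"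
    using exists_minim_Card_order[of ?R] by blast
  then have "is_unbounded_number r"
    unfolding is_unbounded_number_def by blast
  then show ?thesis
    unfolding unbounded_number_def by (rule someI)
qed

lemma groupwise_dense_not_almost_superset:
  assumes B: "infinite B"
  shows "groupwise_dense {A. infinite A \<and> \<not> B \<subseteq>* A}"
  unfolding groupwise_dense_def
proof (intro conjI allI impI)
  fix A C
  assume *: "A \<in> {A. infinite A \<and> \<not> B \<subseteq>* A} \<and> C \<subseteq> A \<and> infinite C"
  then have "B - A \<subseteq> B - C"
    by blast
  with * show "C \<in> {A. infinite A \<and> \<not> B \<subseteq>* A}"
    unfolding almost_subset_def using finite_subset by blast
next
  fix m :: "nat \<Rightarrow> nat"
  assume m: "strict_mono m"
  define X where "X U = (\<Union>i\<in>U. {m i..<m (Suc i)})" for U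
  have inf: "infinite (X U)" if "infinite U" for U
  proof -
    have "m i \<in> X U" if "i \<in> U" for i
      unfolding X_def using that strict_monoD[OF m lessI[of i]] by (intro UN_I[of i]) simp_all
    then have "m ` U \<subseteq> X U"
      by blast
    moreover have "infinite (m ` U)"
      using that strict_mono_imp_inj_on[OF m] by (meson finite_imageD inj_on_subset subset_UNIV)
    ultimately show ?thesis
      using finite_subset by blast
  qed
  have disj: "i = j" if "m i \<le> x" "x < m (Suc i)" "m j \<le> x" "x < m (Suc j)" for i j x
  proof -
    have "m i < m (Suc j)" "m j < m (Suc i)"
      using that by linarith+
    then show ?thesis
      by (simp add: strict_mono_less[OF m])
  qed
  let ?E = "{i::nat. even i}" and ?O = "{i::nat. odd i}"
  have "infinite ?E" "infinite ?O"
  proof -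
    have "range (\<lambda>n. 2 * n) \<subseteq> ?E" "range (\<lambda>n. 2 * n + 1) \<subseteq> ?O"
      by auto
    moreover have "inj (\<lambda>n::nat. 2 * n)" "inj (\<lambda>n::nat. 2 * n + 1)"
      by (simp_all add: inj_def)
    ultimately show "infinite ?E" "infinite ?O"
      using finite_imageD[OF finite_subset] infinite_UNIV_nat by metis+
  qed
  moreover have "X ?E \<inter> X ?O = {}"
  proof (rule equals0I)
    fix x
    assume "x \<in> X ?E \<inter> X ?O"
    then obtain i j where "even i" "odd j" "m i \<le> x" "x < m (Suc i)" "m j \<le> x" "x < m (Suc j)"
      by (auto simp: X_def)
    with disj[of i x j] show False
      by simp
  qed
  then have "B \<subseteq> (B - X ?E) \<union> (B - X ?O)"
    by blast
  then have "infinite (B - X ?E) \<or> infinite (B - X ?O)"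
    using B by (meson finite_subset finite_UnI)
  ultimately have "\<exists>U. infinite U \<and> infinite (B - X U)"
    by blast
  then show "\<exists>U. infinite U \<and> (\<Union>i\<in>U. {m i..<m (Suc i)}) \<in> {A. infinite A \<and> \<not> B \<subseteq>* A}"
    using inf unfolding X_def almost_subset_def by blast
qed auto

lemma groupwise_density_witness_exists:
  "\<exists>\<A>. groupwise_density_witness |UNIV :: nat set set| \<A>"
proof
  let ?N = "\<lambda>B. {A. infinite A \<and> \<not> B \<subseteq>* A}"
  let ?A = "\<lambda>\<alpha>::nat set. ?N (if infinite \<alpha> then \<alpha> else UNIV)"
  have "\<forall>A\<in>?A B. \<not> B \<subseteq>* A" if "infinite B" for B
    using that by simp
  then show "groupwise_density_witness |UNIV :: nat set set| ?A"
    unfolding groupwise_density_witness_def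
    by (auto intro!: groupwise_dense_not_almost_superset simp: Field_card_of)
qed

lemma is_groupwise_density_number_groupwise_density_number:
  "is_groupwise_density_number \<gg>"
proof -
  let ?R = "{r :: nat set rel. Card_order r \<and> (\<exists>\<A>. groupwise_density_witness r \<A>)}"
  have "?R \<noteq> {}"
    using groupwise_density_witness_exists card_of_Card_order by blast
  then obtain r where "r \<in> ?R" "\<forall>r'\<in>?R. r \<le>o r'"
    using exists_minim_Card_order[of ?R] by blast
  then have "is_groupwise_density_number r"
    unfolding is_groupwise_density_number_def by blast
  then show ?thesis
    unfolding groupwise_density_number_def by (rule someI)
qed

lemma groupwise_density_number_le:
  fixes s :: "'b rel"
  assumes s: "Card_order s" and w: "groupwise_density_witness s \<A>"
  shows "\<gg> \<le>o s"
proof (rule ccontr)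
  have g: "is_groupwise_density_number \<gg>"
    by (rule is_groupwise_density_number_groupwise_density_number)
  then have co: "Card_order \<gg>"
    unfolding is_groupwise_density_number_def by blast
  assume "\<not> \<gg> \<le>o s"
  then have less: "s <o \<gg>"
    using not_ordLeq_iff_ordLess s co unfolding card_order_on_def by blast
  then obtain p where p: "Field p < Field \<gg>" "s =o p" "p <o \<gg>"
    using internalize_ordLess[of s \<gg>] s co unfolding card_order_on_def by blast
  have cp: "Card_order p"
    using Card_order_ordIso2[OF s p(2)] .
  obtain f where f: "iso p s f"
    using ordIso_symmetric[OF p(2)] unfolding ordIso_def by blast
  then have "bij_betw f (Field p) (Field s)"
    by (simp add: iso_def)
  then have im: "f ` Field p = Field s"
    by (simp add: bij_betw_def)
  have "groupwise_density_witness p (\<A> \<circ> f)"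
    using w unfolding groupwise_density_witness_def im[symmetric] by simp
  with g cp have "\<gg> \<le>o p"
    unfolding is_groupwise_density_number_def by blast
  with p(3) show False
    using not_ordLess_ordLeq by blast
qed

end

theory Submission
  imports Defs "HOL-Library.Countable_Set" "HOL-Library.Infinite_Set"
begin

text \<open>
  There is a family \<open>\<A> x\<close> of groupwise dense sets, indexed by all reals \<open>x\<close>, such that every infinite
  \<open>B\<close> is almost contained in a member of \<open>\<A> x\<close> for at most \<open>\<bb>\<close> many \<open>x\<close>. If there are at least
  \<open>\<bb>\<^sup>+\<close> reals, any \<open>\<bb>\<^sup>+\<close> many of these sets witness \<open>\<gg> \<le> \<bb>\<^sup>+\<close>; otherwise \<open>\<gg>\<close> is at most the
  continuum, which is at most \<open>\<bb>\<^sup>+\<close>.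

  Each \<open>f\<close> in an unbounded family \<open>F\<close> of size \<open>\<bb>\<close> gives a partition of \<open>\<omega>\<close> into blocks, and for
  every interval partition there is \<open>f \<in> F\<close> such that infinitely many \<open>f\<close>-blocks contain an
  interval of it. The indices of these blocks form an arbitrary infinite set \<open>R\<close>, so one needs a
  way to shrink \<open>R\<close> to a set encoding a prescribed \<open>x\<close>. This is the fact, due to Balcar, Pelant and
  Simon, that forcing with \<open>P(\<omega>)/fin\<close> collapses the continuum to the distributivity number
  \<open>\<hh> \<le> \<bb>\<close>: there are \<open>\<hh>\<close> many almost disjoint families \<open>N j\<close>, with members labelled by reals, such
  that each \<open>R\<close> meets, for each \<open>x\<close>, some \<open>T \<in> N j\<close> with label \<open>x\<close> in an infinite set. Now \<open>\<A> x\<close>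
  consists of the infinite subsets of unions of \<open>f\<close>-blocks with indices in some \<open>T\<close> with label \<open>x\<close>.
  An infinite \<open>B\<close> and a pair \<open>(f, j)\<close> determine \<open>T\<close>, hence \<open>x\<close>.
\<close>

subsection \<open>Dense open families of infinite sets\<close>

text \<open>Diagonalise: pick increasing points, the \<open>n\<close>-th from \<open>X n\<close>.
  Since the sets decrease, only the first \<open>n\<close> points can miss
  \<open>X n\<close>.\<close>

lemma pseudo_intersection:
  fixes X :: "nat \<Rightarrow> nat set"
  assumes inf: "\<And>n. infinite (X n)" and dec: "\<And>n. X (Suc n) \<subseteq> X n"
  shows "\<exists>P. infinite P \<and> P \<subseteq> X 0 \<and> (\<forall>n. P \<subseteq>* X n)"
proof -
  have "\<exists>p. \<forall>n. p n \<in> X n \<and> p n < p (Suc n)"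
  proof (rule dependent_nat_choice)
    show "\<exists>x. x \<in> X 0"
      using inf[of 0] infinite_imp_nonempty by blast
    fix x n
    show "\<exists>y. y \<in> X (Suc n) \<and> x < y"
      using inf[of "Suc n"] unfolding infinite_nat_iff_unbounded by blast
  qed
  then obtain p where p: "\<And>n. p n \<in> X n" "\<And>n. p n < p (Suc n)"
    by blast
  have mono: "X n \<subseteq> X m" if "m \<le> n" for m n
    using dec that by (rule lift_Suc_antimono_le)
  have "strict_mono p"
    using p(2) by (simp add: strict_mono_Suc_iff)
  then have "infinite (range p)"
    using finite_imageD[OF _ strict_mono_imp_inj_on] infinite_UNIV_nat by blast
  moreover have "range p \<subseteq> X 0"
    using p(1) mono[of 0] by blast
  moreover have "range p \<subseteq>* X n" for n
  proof -
    have "range p - X n \<subseteq> p ` {..<n}"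
    proof
      fix y
      assume "y \<in> range p - X n"
      then obtain m where m: "y = p m" "p m \<notin> X n"
        by blast
      then have "\<not> n \<le> m"
        using p(1)[of m] mono[of n m] by blast
      with m show "y \<in> p ` {..<n}"
        by simp
    qed
    then show ?thesis
      unfolding almost_subset_def by (rule finite_subset) simp
  qed
  ultimately show ?thesis by blast
qed

lemma almost_subset_subset: "A \<subseteq> B \<Longrightarrow> A \<subseteq>* B"
  by (simp add: almost_subset_def Diff_eq_empty_iff[THEN iffD2])

lemma almost_subset_trans: "A \<subseteq>* C" if "A \<subseteq>* B" "B \<subseteq>* C"
proof -
  have "A - C \<subseteq> (A - B) \<union> (B - C)" by blast
  with that show ?thesis
    unfolding almost_subset_def by (meson finite_UnI finite_subset)
qed

lemma infinite_Int_mono: "infinite (B \<inter> D)" if "infinite (A \<inter> C)" "A \<subseteq>* B" "C \<subseteq>* D"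
proof
  assume "finite (B \<inter> D)"
  moreover have "A \<inter> C \<subseteq> (B \<inter> D) \<union> (A - B) \<union> (C - D)" by blast
  ultimately show False
    using that finite_subset unfolding almost_subset_def by blast
qed

text \<open>These are the dense open sets of the forcing \<open>P(\<omega>)/fin\<close>. Closure
  under almost subsets makes them invariant under finite changes.\<close>

definition dense_open :: "nat set set \<Rightarrow> bool" where
  "dense_open \<D> \<longleftrightarrow>
     \<D> \<subseteq> {U. infinite U} \<and>
     (\<forall>U V. U \<in> \<D> \<and> infinite V \<and> V \<subseteq>* U \<longrightarrow> V \<in> \<D>) \<and>
     (\<forall>R. infinite R \<longrightarrow> (\<exists>U\<in>\<D>. U \<subseteq> R))"

lemma dense_openI:
  assumes "\<And>U. U \<in> \<D> \<Longrightarrow> infinite U"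
    and "\<And>U V. U \<in> \<D> \<Longrightarrow> infinite V \<Longrightarrow> V \<subseteq>* U \<Longrightarrow> V \<in> \<D>"
    and "\<And>R. infinite R \<Longrightarrow> \<exists>U\<in>\<D>. U \<subseteq> R"
  shows "dense_open \<D>"
  unfolding dense_open_def proof (intro conjI subsetI CollectI allI impI)
  fix U V
  assume "U \<in> \<D> \<and> infinite V \<and> V \<subseteq>* U"
  then show "V \<in> \<D>"
    by (elim conjE) (rule assms(2))
qed (rule assms(1,3), assumption)+

lemma dense_open_infinite: "dense_open \<D> \<Longrightarrow> U \<in> \<D> \<Longrightarrow> infinite U"
  unfolding dense_open_def by (elim conjE) (drule subsetD, assumption, erule CollectD)

lemma dense_open_almost_subset:
  "dense_open \<D> \<Longrightarrow> U \<in> \<D> \<Longrightarrow> infinite V \<Longrightarrow> V \<subseteq>* U \<Longrightarrow> V \<in> \<D>"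
  unfolding dense_open_def by (elim conjE allE[of _ U] allE[of _ V]) (simp only: simp_thms)

lemma dense_open_dense:
  assumes "dense_open \<D>" "infinite R"
  obtains U where "U \<in> \<D>" "U \<subseteq> R"
proof -
  have "\<exists>U\<in>\<D>. U \<subseteq> R"
    using assms by (simp add: dense_open_def)
  then show ?thesis
    using that by (elim bexE)
qed

text \<open>Openness passes to any intersection, so density is the only condition to check. The
  conjunct \<open>infinite U\<close> covers empty \<open>\<C>\<close>, where
  \<open>\<Inter>\<C>\<close> is everything.\<close>

lemma dense_open_Inter:
  assumes D: "\<And>\<D>. \<D> \<in> \<C> \<Longrightarrow> dense_open \<D>"
    and dense: "\<And>R. infinite R \<Longrightarrow> \<exists>U. U \<subseteq> R \<and> infinite U \<and> U \<in> \<Inter>\<C>"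
  shows "dense_open {U. infinite U \<and> U \<in> \<Inter>\<C>}"
proof (rule dense_openI)
  fix U V
  assume "U \<in> {U. infinite U \<and> U \<in> \<Inter>\<C>}" "infinite V" "V \<subseteq>* U"
  then show "V \<in> {U. infinite U \<and> U \<in> \<Inter>\<C>}"
    using dense_open_almost_subset[OF D, of _ U V] by simp
next
  fix R :: "nat set"
  assume "infinite R"
  from dense[OF this] obtain U where "U \<subseteq> R" "infinite U \<and> U \<in> \<Inter>\<C>"
    by (elim exE conjE) simp
  then show "\<exists>U\<in>{U. infinite U \<and> U \<in> \<Inter>\<C>}. U \<subseteq> R"
    by (intro bexI[of _ U]) simp_all
qed simp

text \<open>The forcing is countably closed: shrink \<open>R\<close> step by step into one dense set
  after another and take a pseudo-intersection, which lies in all of them by openness.\<close>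

lemma countable_dense_open_Inter:
  assumes C: "countable \<C>" and D: "\<And>\<D>. \<D> \<in> \<C> \<Longrightarrow> dense_open \<D>" and R: "infinite R"
  shows "\<exists>U. U \<subseteq> R \<and> infinite U \<and> U \<in> \<Inter>\<C>"
proof (cases "\<C> = {}")
  case True
  then show ?thesis using R by auto
next
  case False
  define \<D> where "\<D> = from_nat_into \<C>"
  have \<D>: "range \<D> = \<C>"
    unfolding \<D>_def using False C by (rule range_from_nat_into)
  then have do: "dense_open (\<D> n)" for n
    using D by blast
  have "\<exists>X. \<forall>n. (infinite (X n) \<and> X n \<subseteq> R) \<and> (X (Suc n) \<subseteq> X n \<and> X (Suc n) \<in> \<D> n)"
  proof (rule dependent_nat_choice)
    show "\<exists>X. infinite X \<and> X \<subseteq> R"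
      using R by blast
    fix X n
    assume X: "infinite X \<and> X \<subseteq> R"
    then obtain U where U: "U \<in> \<D> n" "U \<subseteq> X"
      using dense_open_dense[OF do, of X n] by blast
    then show "\<exists>Y. (infinite Y \<and> Y \<subseteq> R) \<and> Y \<subseteq> X \<and> Y \<in> \<D> n"
      using X dense_open_infinite[OF do, of U n] by blast
  qed
  then obtain X where X: "\<And>n. infinite (X n)" "\<And>n. X n \<subseteq> R" "\<And>n. X (Suc n) \<subseteq> X n"
    "\<And>n. X (Suc n) \<in> \<D> n"
    by blast
  obtain P where P: "infinite P" "P \<subseteq> X 0" "\<And>n. P \<subseteq>* X n"
    using pseudo_intersection[of X, OF X(1,3)] by (elim exE conjE) simp
  have "P \<in> \<D> n" for n
    using dense_open_almost_subset[OF do X(4) P(1,3)] .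
  then have "P \<in> \<Inter>\<C>"
    unfolding \<D>[symmetric] by simp
  moreover have "P \<subseteq> R"
    using P(2) X(2)[of 0] by (rule subset_trans)
  ultimately show ?thesis
    using P(1) by (intro exI[of _ P] conjI)
qed

section \<open>Maximal almost disjoint families inside dense open sets\<close>

definition almost_disjoint :: "nat set set \<Rightarrow> bool" where
  "almost_disjoint \<T> \<longleftrightarrow> (\<forall>S\<in>\<T>. \<forall>T\<in>\<T>. infinite (S \<inter> T) \<longrightarrow> S = T)"

lemma almost_disjointD:
  "almost_disjoint \<T> \<Longrightarrow> S \<in> \<T> \<Longrightarrow> T \<in> \<T> \<Longrightarrow> infinite (S \<inter> T) \<Longrightarrow> S = T"
  unfolding almost_disjoint_def by blast

text \<open>Take a maximal family by Zorn's lemma. If \<open>R\<close> met all its members finitely,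
  a member of \<open>\<D>\<close> inside \<open>R\<close> could be added.\<close>

lemma maximal_almost_disjoint_exists:
  assumes "dense_open \<D>"
  obtains \<T> where "\<T> \<subseteq> \<D>" "almost_disjoint \<T>"
    "\<And>R. infinite R \<Longrightarrow> \<exists>T\<in>\<T>. infinite (T \<inter> R)"
proof -
  let ?A = "{\<T>. \<T> \<subseteq> \<D> \<and> almost_disjoint \<T>}"
  have "\<exists>M\<in>?A. \<forall>X\<in>?A. M \<subseteq> X \<longrightarrow> X = M"
  proof (rule subset_Zorn')
    fix C
    assume C: "subset.chain ?A C"
    have "almost_disjoint (\<Union>C)"
      unfolding almost_disjoint_def
    proof (intro ballI impI)
      fix S T
      assume "S \<in> \<Union>C" "T \<in> \<Union>C" and inf: "infinite (S \<inter> T)"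
      then obtain M N where MN: "M \<in> C" "N \<in> C" "S \<in> M" "T \<in> N"
        by blast
      then have "M \<subseteq> N \<or> N \<subseteq> M"
        using C by (simp add: subset_chain_def)
      then obtain L where L: "L \<in> C" "S \<in> L" "T \<in> L"
        using MN by blast
      then have "almost_disjoint L"
        using C by (auto simp: subset_chain_def)
      then show "S = T"
        using L(2,3) inf by (rule almost_disjointD)
    qed
    with C show "\<Union>C \<in> ?A"
      unfolding subset_chain_def by blast
  qed
  then obtain \<T> where \<T>: "\<T> \<in> ?A" "\<forall>X\<in>?A. \<T> \<subseteq> X \<longrightarrow> X = \<T>" ..
  then have T: "\<T> \<subseteq> \<D>" "almost_disjoint \<T>"
    and max: "\<And>X. X \<subseteq> \<D> \<Longrightarrow> almost_disjoint X \<Longrightarrow> \<T> \<subseteq> X \<Longrightarrow> X = \<T>"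
    by simp_all
  have "\<exists>T\<in>\<T>. infinite (T \<inter> R)" if R: "infinite R" for R
  proof (rule ccontr)
    assume no: "\<not> (\<exists>T\<in>\<T>. infinite (T \<inter> R))"
    obtain U where U: "U \<in> \<D>" "U \<subseteq> R"
      using dense_open_dense[OF assms R] .
    then have fin: "finite (T \<inter> U)" if "T \<in> \<T>" for T
      using no that finite_subset[of "T \<inter> U" "T \<inter> R"] by blast
    have "almost_disjoint (insert U \<T>)"
      using T(2) fin unfolding almost_disjoint_def by (auto simp: Int_commute)
    with max[of "insert U \<T>"] U T(1) have "U \<in> \<T>"
      by blast
    with fin[of U] dense_open_infinite[OF assms U(1)] show False
      by simp
  qed
  with T show ?thesis by (rule that)
qed

lemma dense_open_below:
  assumes "\<And>R. infinite R \<Longrightarrow> \<exists>T\<in>\<T>. infinite (T \<inter> R)"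
  shows "dense_open {U. infinite U \<and> (\<exists>T\<in>\<T>. U \<subseteq>* T)}"
proof (rule dense_openI)
  fix R :: "nat set"
  assume "infinite R"
  then obtain T where "T \<in> \<T>" "infinite (T \<inter> R)"
    using assms by blast
  then show "\<exists>U\<in>{U. infinite U \<and> (\<exists>T\<in>\<T>. U \<subseteq>* T)}. U \<subseteq> R"
    using almost_subset_subset[of "T \<inter> R" T] by blast
next
  fix U V
  assume "U \<in> {U. infinite U \<and> (\<exists>T\<in>\<T>. U \<subseteq>* T)}" "infinite V" "V \<subseteq>* U"
  then show "V \<in> {U. infinite U \<and> (\<exists>T\<in>\<T>. U \<subseteq>* T)}"
    using almost_subset_trans[of V U] by blast
qed simp

subsection \<open>Families of dense open sets without a common member\<close>

definition shattering :: "nat set set set \<Rightarrow> bool" where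
  "shattering \<DD> \<longleftrightarrow> (\<forall>\<D>\<in>\<DD>. dense_open \<D>) \<and> \<not> (\<exists>U. infinite U \<and> U \<in> \<Inter>\<DD>)"

text \<open>The size of a minimal shattering family is the distributivity number \<open>\<hh>\<close>.\<close>

definition minimal_shattering :: "nat set set set \<Rightarrow> bool" where
  "minimal_shattering \<DD> \<longleftrightarrow> shattering \<DD> \<and> (\<forall>\<EE>. shattering \<EE> \<longrightarrow> |\<DD>| \<le>o |\<EE>| )"

text \<open>The order below an infinite set looks like the whole order. Pulling back along an
  enumeration of that set transfers dense openness.\<close>

lemma dense_open_pullback:
  assumes D: "dense_open \<D>" and e: "strict_mono (e :: nat \<Rightarrow> nat)"
  shows "dense_open {U. infinite U \<and> e ` U \<in> \<D>}"
proof (rule dense_openI)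
  have inj: "inj e"
    using e by (rule strict_mono_imp_inj_on)
  then have inf: "infinite (e ` U)" if "infinite U" for U
    using that finite_imageD[of e U] inj_on_subset by blast
  {
    fix U V
    assume U: "U \<in> {U. infinite U \<and> e ` U \<in> \<D>}" and V: "infinite V" "V \<subseteq>* U"
    have "e ` V - e ` U \<subseteq> e ` (V - U)"
      by blast
    then have "e ` V \<subseteq>* e ` U"
      using V(2) unfolding almost_subset_def by (meson finite_imageI finite_subset)
    then have "e ` V \<in> \<D>"
      using U dense_open_almost_subset[OF D, of "e ` U" "e ` V"] inf[OF V(1)] by simp
    with V(1) show "V \<in> {U. infinite U \<and> e ` U \<in> \<D>}"
      by simp
  next
    fix R :: "nat set"
    assume "infinite R"
    then obtain U where U: "U \<in> \<D>" "U \<subseteq> e ` R"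
      using dense_open_dense[OF D inf] by blast
    then have eq: "e ` (e -` U) = U"
      by blast
    moreover have "infinite (e -` U)"
      using dense_open_infinite[OF D U(1)] eq finite_imageI by metis
    moreover have "e -` U \<subseteq> R"
      using U(2) inj by (auto dest: injD)
    ultimately show "\<exists>U\<in>{U. infinite U \<and> e ` U \<in> \<D>}. U \<subseteq> R"
      using U(1) by (intro bexI[of _ "e -` U"]) simp_all
  }
qed simp

text \<open>Minimality of \<open>\<DD>\<close> alone gives a common member somewhere. Applied to the
  pullbacks along an enumeration of \<open>R\<close>, it gives one below \<open>R\<close>.\<close>

lemma minimal_shattering_small_Inter:
  assumes DD: "minimal_shattering \<DD>"
    and EE: "\<And>\<D>. \<D> \<in> \<EE> \<Longrightarrow> dense_open \<D>" "|\<EE>| <o |\<DD>|" and R: "infinite R"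
  shows "\<exists>U. U \<subseteq> R \<and> infinite U \<and> U \<in> \<Inter>\<EE>"
proof -
  define e where "e = enumerate R"
  have e: "strict_mono e" "range e = R"
    unfolding e_def using R by (simp_all add: strict_mono_enumerate range_enumerate)
  let ?pull = "\<lambda>\<D>. {U. infinite U \<and> e ` U \<in> \<D>}"
  have "|?pull ` \<EE>| <o |\<DD>|"
    using card_of_image EE(2) by (rule ordLeq_ordLess_trans)
  then have "\<not> shattering (?pull ` \<EE>)"
    using DD not_ordLess_ordLeq unfolding minimal_shattering_def by blast
  moreover have "dense_open \<D>" if "\<D> \<in> ?pull ` \<EE>" for \<D>
    using that EE(1) dense_open_pullback[OF _ e(1)] by blast
  ultimately obtain U where U: "infinite U" "U \<in> \<Inter>(?pull ` \<EE>)"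
    unfolding shattering_def by blast
  have "infinite (e ` U)"
    using U(1) e(1) finite_imageD inj_on_subset strict_mono_imp_inj_on by (metis subset_UNIV)
  moreover have "e ` U \<in> \<Inter>\<EE>"
    using U(2) by blast
  ultimately show ?thesis
    using e(2) by (intro exI[of _ "e ` U"]) auto
qed

text \<open>The strict predecessors of \<open>j\<close> number fewer than \<open>|\<DD>|\<close>, so
  minimality handles them; one more shrinking step enters \<open>G j\<close> itself.\<close>

lemma dense_open_Inter_under:
  assumes DD: "minimal_shattering \<DD>" and G: "\<And>i. i \<in> \<DD> \<Longrightarrow> dense_open (G i)" and j: "j \<in> \<DD>"
  shows "dense_open {U. infinite U \<and> U \<in> \<Inter>(G ` under |\<DD>| j)}"
proof (rule dense_open_Inter)
  have sub: "under |\<DD>| j \<subseteq> \<DD>"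
    using under_Field[of "|\<DD>|" j] by (simp add: Field_card_of)
  then show do: "dense_open \<D>" if "\<D> \<in> G ` under |\<DD>| j" for \<D>
    using that G by blast
  fix R :: "nat set"
  assume R: "infinite R"
  have sub': "underS |\<DD>| j \<subseteq> under |\<DD>| j"
    by (rule underS_subset_under)
  have "|underS |\<DD>| j| <o |\<DD>|"
    using card_of_underS[OF card_of_Card_order] j by (simp add: Field_card_of)
  then have "|G ` underS |\<DD>| j| <o |\<DD>|"
    using card_of_image ordLeq_ordLess_trans by blast
  then obtain U where U: "U \<subseteq> R" "infinite U" "U \<in> \<Inter>(G ` underS |\<DD>| j)"
    using minimal_shattering_small_Inter[OF DD _ _ R, of "G ` underS |\<DD>| j"] do sub' by blast
  obtain V where V: "V \<in> G j" "V \<subseteq> U"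
    using dense_open_dense[OF G[OF j] U(2)] .
  then have inf: "infinite V"
    using dense_open_infinite[OF G[OF j]] by blast
  have "V \<in> G i" if i: "i \<in> under |\<DD>| j" for i
  proof (cases "i = j")
    case False
    then have "i \<in> underS |\<DD>| j"
      using i by (simp add: under_def underS_def)
    moreover have "dense_open (G i)"
      using i sub G by blast
    ultimately show ?thesis
      using dense_open_almost_subset[of "G i" U V] U(3) inf almost_subset_subset[OF V(2)] by blast
  qed (use V in simp)
  then show "\<exists>U. U \<subseteq> R \<and> infinite U \<and> U \<in> \<Inter>(G ` under |\<DD>| j)"
    using V(2) U(1) inf by (intro exI[of _ V]) auto
qed

text \<open>The distributivity number has uncountable cofinality. If \<open>C\<close> were cofinal,
  the countably many sets \<open>E c\<close> would have a common member, which would then lie in all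
  of \<open>\<Inter>\<DD>\<close>.\<close>

lemma minimal_shattering_countable_bounded:
  assumes DD: "minimal_shattering \<DD>" and C: "countable C" "C \<subseteq> \<DD>"
  shows "\<exists>j\<in>\<DD>. C \<subseteq> under |\<DD>| j"
proof (rule ccontr)
  assume no: "\<not> (\<exists>j\<in>\<DD>. C \<subseteq> under |\<DD>| j)"
  have do: "\<And>\<D>. \<D> \<in> \<DD> \<Longrightarrow> dense_open \<D>" and empty: "\<And>U. infinite U \<Longrightarrow> U \<notin> \<Inter>\<DD>"
    using DD unfolding minimal_shattering_def shattering_def by blast+
  \<comment> \<open>The image under the identity matches the form of
    \<open>dense_open_Inter_under\<close>.\<close>
  define E where "E c = {U. infinite U \<and> U \<in> \<Inter>((\<lambda>i. i) ` under |\<DD>| c)}" for c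
  have "dense_open (E c)" if "c \<in> \<DD>" for c
    unfolding E_def using DD do that by (rule dense_open_Inter_under)
  then have "\<exists>U. U \<subseteq> UNIV \<and> infinite U \<and> U \<in> \<Inter>(E ` C)"
    using C by (intro countable_dense_open_Inter) auto
  then obtain U where U: "infinite U" "U \<in> \<Inter>(E ` C)"
    by blast
  have "U \<in> j" if j: "j \<in> \<DD>" for j
  proof -
    obtain c where c: "c \<in> C" "c \<notin> under |\<DD>| j"
      using no j by blast
    then have "(c, j) \<notin> |\<DD>|" "c \<in> \<DD>"
      using C(2) by (auto simp: under_def)
    then have "(j, c) \<in> |\<DD>|"
      using card_of_well_order_on[of \<DD>] j
      by (cases "c = j") (auto simp: well_order_on_def linear_order_on_def partial_order_on_def preorder_on_def
          total_on_def refl_on_def)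
    then have "j \<in> under |\<DD>| c"
      by (simp add: under_def)
    with c U(2) show ?thesis
      unfolding E_def by blast
  qed
  with empty[OF U(1)] show False
    by blast
qed

subsection \<open>The base matrix\<close>

text \<open>Choose by recursion along the cardinal order of \<open>I\<close>: before stage
  \<open>i\<close> fewer than \<open>|I|\<close> values are used, so \<open>S i\<close> still has a
  fresh one.\<close>

lemma distinct_representatives:
  fixes S :: "'i \<Rightarrow> 'a set"
  assumes S: "\<And>i. i \<in> I \<Longrightarrow> |I| \<le>o |S i|"
  shows "\<exists>f. inj_on f I \<and> (\<forall>i\<in>I. f i \<in> S i)"
proof -
  let ?r = "|I|"
  have wo: "Well_order ?r" and co: "Card_order ?r"
    by (simp_all add: card_of_Well_order card_of_Card_order)
  have "\<exists>f. \<forall>i. i \<in> I \<longrightarrow> f i \<in> S i - f ` underS ?r i"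
  proof (rule dependent_wf_choice)
    show "wf (?r - Id)"
      using wo by (simp add: well_order_on_def)
  next
    fix f g :: "'i \<Rightarrow> 'a" and i x
    assume "\<And>z. (z, i) \<in> ?r - Id \<Longrightarrow> f z = g z"
    then have "f ` underS ?r i = g ` underS ?r i"
      by (intro image_cong) (auto simp: underS_def)
    then show "(i \<in> I \<longrightarrow> x \<in> S i - f ` underS ?r i) = (i \<in> I \<longrightarrow> x \<in> S i - g ` underS ?r i)"
      by simp
  next
    fix i and f :: "'i \<Rightarrow> 'a"
    show "\<exists>x. i \<in> I \<longrightarrow> x \<in> S i - f ` underS ?r i"
    proof (cases "i \<in> I")
      case True
      have "|f ` underS ?r i| \<le>o |underS ?r i|"
        by (rule card_of_image)
      also have "|underS ?r i| <o ?r"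
        using card_of_underS[OF co] True by (simp add: Field_card_of)
      also have "?r \<le>o |S i|"
        by (rule S[OF True])
      finally have "\<not> S i \<subseteq> f ` underS ?r i"
        using card_of_mono1 not_ordLess_ordLeq by blast
      then show ?thesis by blast
    qed simp
  qed
  then obtain f where f: "\<And>i. i \<in> I \<Longrightarrow> f i \<in> S i" "\<And>i. i \<in> I \<Longrightarrow> f i \<notin> f ` underS ?r i"
    by blast
  have "inj_on f I"
  proof (rule inj_onI, rule ccontr)
    fix i j
    assume ij: "i \<in> I" "j \<in> I" "f i = f j" "i \<noteq> j"
    then have "(i, j) \<in> ?r \<or> (j, i) \<in> ?r"
      using card_of_well_order_on[of I]
      by (auto simp: well_order_on_def linear_order_on_def total_on_def)
    then have "i \<in> underS ?r j \<or> j \<in> underS ?r i"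
      using ij by (auto simp: underS_def)
    then show False
      using f(2) ij by (metis imageI)
  qed
  then show ?thesis
    using f(1) by blast
qed

text \<open>Some \<open>\<D>\<close> omits \<open>R\<close>. A member \<open>S\<close> of
  \<open>M \<D>\<close> hitting \<open>R\<close> cannot almost contain \<open>R\<close>, by
  openness, so the infinite remainder \<open>R - S\<close> is hit by another member.\<close>

lemma shattering_branching:
  assumes DD: "shattering \<DD>"
    and M: "\<And>\<D>. \<D> \<in> \<DD> \<Longrightarrow> M \<D> \<subseteq> \<D>"
      "\<And>\<D> R. \<D> \<in> \<DD> \<Longrightarrow> infinite R \<Longrightarrow> \<exists>T\<in>M \<D>. infinite (T \<inter> R)"
    and R: "infinite R"
  shows "\<exists>\<D>\<in>\<DD>. \<exists>S\<in>M \<D>. \<exists>T\<in>M \<D>. S \<noteq> T \<and> infinite (S \<inter> R) \<and> infinite (T \<inter> R)"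
proof -
  obtain \<D> where D: "\<D> \<in> \<DD>" "R \<notin> \<D>"
    using DD R unfolding shattering_def by blast
  then have do: "dense_open \<D>"
    using DD unfolding shattering_def by blast
  obtain S where S: "S \<in> M \<D>" "infinite (S \<inter> R)"
    using M(2)[OF D(1) R] by blast
  then have "S \<in> \<D>"
    using M(1)[OF D(1)] by blast
  then have "infinite (R - S)"
    using dense_open_almost_subset[OF do _ R, of S] D(2) by (auto simp: almost_subset_def)
  then obtain T where T: "T \<in> M \<D>" "infinite (T \<inter> (R - S))"
    using M(2)[OF D(1)] by blast
  then have "infinite (T \<inter> R)"
    by (metis Diff_subset Int_mono finite_subset order_refl)
  moreover have "S \<noteq> T"
    using T(2) by auto
  ultimately show ?thesis
    using D(1) S T(1) by blast
qed

text \<open>Intersecting with the parent node lets \<open>s\<close> return members of an almost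
  disjoint family that need not lie inside the node. These members later tell the branches
  apart.\<close>

fun tree_path :: "(nat set \<Rightarrow> bool \<Rightarrow> nat set) \<Rightarrow> nat set \<Rightarrow> nat set \<Rightarrow> nat \<Rightarrow> nat set" where
  "tree_path s R x 0 = R"
| "tree_path s R x (Suc n) = s (tree_path s R x n) (n \<in> x) \<inter> tree_path s R x n"

lemma tree_path_cong:
  assumes "\<And>i. i < n \<Longrightarrow> i \<in> x \<longleftrightarrow> i \<in> y"
  shows "tree_path s R x n = tree_path s R y n"
  using assms by (induction n) auto

text \<open>
  Every infinite set \<open>R\<close> is split by some \<open>mad \<D>\<close>; iterating yields a binary tree of subsets of \<open>R\<close>.
  The countably many \<open>\<D>\<close> involved lie below a single \<open>j\<close>, and the continuum many branches are
  separated by \<open>N j\<close>, which refines all \<open>mad \<D>\<close> with \<open>\<D>\<close> below \<open>j\<close>.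
\<close>

lemma base_matrix:
  assumes DD: "minimal_shattering \<DD>"
  shows "\<exists>N. (\<forall>j\<in>\<DD>. almost_disjoint (N j)) \<and>
    (\<forall>R. infinite R \<longrightarrow> (\<exists>j\<in>\<DD>. |UNIV :: nat set set| \<le>o |{T \<in> N j. infinite (T \<inter> R)}| ))"
proof -
  have sh: "shattering \<DD>" and do: "\<And>\<D>. \<D> \<in> \<DD> \<Longrightarrow> dense_open \<D>"
    using DD unfolding minimal_shattering_def shattering_def by blast+
  have "\<exists>\<T>. \<T> \<subseteq> \<D> \<and> almost_disjoint \<T> \<and> (\<forall>R. infinite R \<longrightarrow> (\<exists>T\<in>\<T>. infinite (T \<inter> R)))"
    if D: "dense_open \<D>" for \<D>
    using maximal_almost_disjoint_exists[OF D] by metis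
  then obtain mad where mad: "\<And>\<D>. dense_open \<D> \<Longrightarrow> mad \<D> \<subseteq> \<D>"
    "\<And>\<D>. dense_open \<D> \<Longrightarrow> almost_disjoint (mad \<D>)"
    "\<And>\<D> R. dense_open \<D> \<Longrightarrow> infinite R \<Longrightarrow> \<exists>T\<in>mad \<D>. infinite (T \<inter> R)"
    by metis
  \<comment> \<open>Belonging to \<open>G \<D>\<close> means lying almost below a single member of
    \<open>mad \<D>\<close>. A member of \<open>E j\<close> does so for every \<open>\<D>\<close>
    under \<open>j\<close>.\<close>
  define G where "G \<D> = {U. infinite U \<and> (\<exists>T\<in>mad \<D>. U \<subseteq>* T)}" for \<D>
  have G: "dense_open (G \<D>)" if "\<D> \<in> \<DD>" for \<D>
    unfolding G_def using mad(3)[OF do[OF that]] by (rule dense_open_below)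
  define E where "E j = {U. infinite U \<and> U \<in> \<Inter>(G ` under |\<DD>| j)}" for j
  have E: "dense_open (E j)" if "j \<in> \<DD>" for j
    unfolding E_def using DD G that by (rule dense_open_Inter_under)
  define N where "N j = mad (E j)" for j
  have ad: "almost_disjoint (N j)" if "j \<in> \<DD>" for j
    unfolding N_def using mad(2)[OF E[OF that]] .
  have "\<exists>j\<in>\<DD>. |UNIV :: nat set set| \<le>o |{T \<in> N j. infinite (T \<inter> R)}|"
    if R: "infinite R" for R
  proof -
    \<comment> \<open>The guard makes the choice total; all nodes of the tree turn out to be
      infinite.\<close>
    have "\<exists>\<D> s. infinite X \<longrightarrow> \<D> \<in> \<DD> \<and> s True \<noteq> s False \<and> (\<forall>b. s b \<in> mad \<D> \<and> infinite (s b \<inter> X))"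
      for X
    proof (cases "infinite X")
      case True
      have "\<exists>\<D>\<in>\<DD>. \<exists>S\<in>mad \<D>. \<exists>T\<in>mad \<D>. S \<noteq> T \<and> infinite (S \<inter> X) \<and> infinite (T \<inter> X)"
        using sh mad(1)[OF do] mad(3)[OF do] True by (rule shattering_branching)
      then obtain \<D> S T where D: "\<D> \<in> \<DD>" "S \<in> mad \<D>" "T \<in> mad \<D>" "S \<noteq> T"
        "infinite (S \<inter> X)" "infinite (T \<inter> X)"
        by blast
      then show ?thesis
        by (intro exI[of _ \<D>] exI[of _ "\<lambda>b. if b then S else T"]) auto
    qed simp
    then obtain d s where ds: "\<And>X. infinite X \<Longrightarrow> d X \<in> \<DD>"
      "\<And>X. infinite X \<Longrightarrow> s X True \<noteq> s X False"
      "\<And>X b. infinite X \<Longrightarrow> s X b \<in> mad (d X)"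
      "\<And>X b. infinite X \<Longrightarrow> infinite (s X b \<inter> X)"
      by metis
    define X where "X = tree_path s R"
    have X_inf: "infinite (X x n)" for x n
      unfolding X_def using R ds(4) by (induction n) auto
    have X_dec: "X x (Suc n) \<subseteq> X x n" for x n
      unfolding X_def by simp
    \<comment> \<open>A node at depth \<open>n\<close> depends only on the digits below
      \<open>n\<close>, so finite sets \<open>z\<close> already reach every node, although there are
      continuum many branches.\<close>
    let ?C = "(\<lambda>(z, n). d (X z n)) ` ({z. finite z} \<times> UNIV)"
    have "countable ?C"
      by (intro countable_image countable_SIGMA) (simp_all add: countable_Collect_finite)
    moreover have "?C \<subseteq> \<DD>"
      using ds(1) X_inf by auto
    ultimately have "\<exists>j\<in>\<DD>. ?C \<subseteq> under |\<DD>| j"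
      by (rule minimal_shattering_countable_bounded[OF DD])
    then obtain j where j: "j \<in> \<DD>" "?C \<subseteq> under |\<DD>| j"
      by blast
    have dj: "d (X x n) \<in> under |\<DD>| j" for x n
    proof -
      have "X x n = X (x \<inter> {..<n}) n"
        unfolding X_def by (rule tree_path_cong) simp
      then have "d (X x n) = (\<lambda>(z, n). d (X z n)) (x \<inter> {..<n}, n)"
        by simp
      moreover have "(x \<inter> {..<n}, n) \<in> {z. finite z} \<times> UNIV"
        by simp
      ultimately have "d (X x n) \<in> ?C"
        by (rule image_eqI)
      with j(2) show ?thesis by (rule subsetD)
    qed
    have "\<exists>T\<in>N j. infinite (T \<inter> R) \<and> (\<forall>n. infinite (T \<inter> X x n))" for x
    proof -
      obtain P where P: "infinite P" "\<And>n. P \<subseteq>* X x n"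
        using pseudo_intersection[of "X x"] X_inf X_dec by blast
      \<comment> \<open>Hitting the pseudo-intersection of a branch in an infinite set forces
        hitting every node of the branch in an infinite set.\<close>
      obtain T where T: "T \<in> N j" "infinite (T \<inter> P)"
        using mad(3)[OF E[OF j(1)] P(1)] unfolding N_def by blast
      have "infinite (T \<inter> X x n)" for n
        using infinite_Int_mono[OF T(2) almost_subset_subset[OF order_refl] P(2)] .
      moreover from this[of 0] have "infinite (T \<inter> R)"
        by (simp add: X_def)
      ultimately show ?thesis
        using T(1) by blast
    qed
    then obtain t where t: "\<And>x. t x \<in> N j" "\<And>x. infinite (t x \<inter> R)" "\<And>x n. infinite (t x \<inter> X x n)"
      by metis
    have "inj t"
    proof (rule injI, rule ccontr)
      fix x y
      assume eq: "t x = t y" and ne: "x \<noteq> y"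
      then have "\<exists>n. (n \<in> x) \<noteq> (n \<in> y)"
        by auto
      \<comment> \<open>At the first differing digit both branches pass through the same node
        \<open>Z\<close> and continue into different members of \<open>mad (d Z)\<close>. As
        \<open>t x\<close> is almost below one member of \<open>mad (d Z)\<close>, it cannot hit
        both in infinite sets.\<close>
      define n where "n = (LEAST n. (n \<in> x) \<noteq> (n \<in> y))"
      have n: "(n \<in> x) \<noteq> (n \<in> y)"
        unfolding n_def using \<open>\<exists>n. (n \<in> x) \<noteq> (n \<in> y)\<close> by (rule LeastI_ex)
      have "X x n = X y n"
        unfolding X_def
        by (rule tree_path_cong) (use not_less_Least[of _ "\<lambda>n. (n \<in> x) \<noteq> (n \<in> y)"] n_def in blast)
      define Z where "Z = X x n"
      have Z: "infinite Z"
        unfolding Z_def by (rule X_inf)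
      have "t x \<in> E j"
        using t(1) mad(1)[OF E[OF j(1)]] unfolding N_def by blast
      then have "t x \<in> G (d Z)"
        using dj[of x n] unfolding E_def Z_def by blast
      then obtain T where T: "T \<in> mad (d Z)" "t x \<subseteq>* T"
        unfolding G_def by blast
      have *: "T = s Z b" if "infinite (t x \<inter> (s Z b \<inter> Z))" for b
      proof -
        have "infinite (T \<inter> s Z b)"
          using infinite_Int_mono[OF that T(2)] almost_subset_subset[of "s Z b \<inter> Z" "s Z b"] by blast
        then show ?thesis
          using almost_disjointD[OF mad(2)[OF do[OF ds(1)[OF Z]]] T(1) ds(3)[OF Z]] by blast
      qed
      have "X x (Suc n) = s Z (n \<in> x) \<inter> Z"
        by (simp add: X_def Z_def)
      then have "T = s Z (n \<in> x)"
        using t(3)[of x "Suc n"] * by simp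
      moreover have "X y (Suc n) = s Z (n \<in> y) \<inter> Z"
        using \<open>X x n = X y n\<close> by (simp add: X_def Z_def)
      then have "T = s Z (n \<in> y)"
        using t(3)[of y "Suc n"] * eq by simp
      ultimately show False
        using n ds(2)[OF Z] by (cases "n \<in> x"; cases "n \<in> y") auto
    qed
    then have "|UNIV :: nat set set| \<le>o |{T \<in> N j. infinite (T \<inter> R)}|"
      using t(1,2) by (intro card_of_ordLeq[THEN iffD1] exI[of _ t]) auto
    with j(1) show ?thesis by blast
  qed
  with ad show ?thesis
    by blast
qed

text \<open>There are only continuum many pairs \<open>(R, x)\<close>. At a level where each
  relevant \<open>R\<close> has continuum many hits, distinct representatives for these pairs exist,
  and a representative determines its pair and thus its label.\<close>

lemma labelled_base_matrix:
  assumes DD: "minimal_shattering \<DD>"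
  shows "\<exists>N L. (\<forall>j\<in>\<DD>. almost_disjoint (N j)) \<and>
    (\<forall>R (x :: nat set). infinite R \<longrightarrow> (\<exists>j\<in>\<DD>. \<exists>T\<in>N j. infinite (T \<inter> R) \<and> L j T = x))"
proof -
  let ?ad = "\<lambda>N. \<forall>j\<in>\<DD>. almost_disjoint (N j)"
  let ?large = "\<lambda>N. \<forall>R. infinite R \<longrightarrow>
    (\<exists>j\<in>\<DD>. |UNIV :: nat set set| \<le>o |{T \<in> N j. infinite (T \<inter> R)}| )"
  obtain N where "?ad N \<and> ?large N"
    using base_matrix[OF DD] ..
  then have N: "?ad N" "?large N"
    by simp_all
  define hit where "hit j R = {T \<in> N j. infinite (T \<inter> R)}" for j R
  define I where "I j = {(R, x :: nat set). |UNIV :: nat set set| \<le>o |hit j R|}" for j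
  have "\<exists>f. inj_on f (I j) \<and> (\<forall>i\<in>I j. f i \<in> hit j (fst i))" for j
  proof -
    have "|I j| \<le>o |hit j (fst i)|" if i: "i \<in> I j" for i
    proof -
      have inf: "infinite (UNIV :: nat set set)"
        by (simp add: Finite_Set.finite_set)
      have "|I j| \<le>o |(UNIV :: nat set set) \<times> (UNIV :: nat set set)|"
        by (intro card_of_mono1) simp
      also have "|(UNIV :: nat set set) \<times> (UNIV :: nat set set)| =o |UNIV :: nat set set|"
        using card_of_Times_same_infinite[OF inf] .
      also have "|UNIV :: nat set set| \<le>o |hit j (fst i)|"
        using i unfolding I_def by auto
      finally show ?thesis .
    qed
    then show ?thesis
      by (rule distinct_representatives)
  qed
  then obtain f where "\<And>j. inj_on (f j) (I j) \<and> (\<forall>i\<in>I j. f j i \<in> hit j (fst i))"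
    by metis
  then have f: "\<And>j. inj_on (f j) (I j)" "\<And>j i. i \<in> I j \<Longrightarrow> f j i \<in> hit j (fst i)"
    by blast+
  \<comment> \<open>Sets that represent no pair at level \<open>j\<close> get an arbitrary
    label.\<close>
  define L where "L j T = snd (inv_into (I j) (f j) T)" for j T
  have "\<exists>j\<in>\<DD>. \<exists>T\<in>N j. infinite (T \<inter> R) \<and> L j T = x" if R: "infinite R" for R x
  proof -
    obtain j where j: "j \<in> \<DD>" "(R, x) \<in> I j"
      using N(2)[rule_format, OF R] unfolding I_def hit_def by auto
    then have "f j (R, x) \<in> hit j R"
      using f(2) by fastforce
    moreover have "L j (f j (R, x)) = x"
      using inv_into_f_f[OF f(1) j(2)] by (simp add: L_def)
    ultimately show ?thesis
      using j(1) unfolding hit_def by blast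
  qed
  then show ?thesis
    by (intro exI[of _ N] exI[of _ L] conjI N(1) allI impI)
qed

subsection \<open>Unbounded families\<close>

lemma infinite_unbounded_family:
  assumes "unbounded_family F"
  shows "infinite F"
proof
  assume fin: "finite F"
  have "le_Jbd f (\<lambda>n. \<Sum>h\<in>F. h n)" if "f \<in> F" for f
  proof -
    have "f n \<le> (\<Sum>h\<in>F. h n)" for n
      using member_le_sum[of f F "\<lambda>h. h n"] fin that by simp
    then show ?thesis
      by (simp add: le_Jbd_def)
  qed
  with assms show False
    unfolding unbounded_family_def by blast
qed

text \<open>Passing to pointwise larger functions keeps a family unbounded. Monotonicity is for
  \<open>sparse\<close>, and \<open>n < f n\<close> makes the iterates of \<open>f\<close> increase,
  as the blocks require.\<close>

lemma unbounded_number_attained: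
  "\<exists>F. unbounded_family F \<and> |F| \<le>o \<bb> \<and> (\<forall>f\<in>F. mono f \<and> (\<forall>n. n < f n))"
proof -
  obtain F where F: "unbounded_family F" "\<bb> = |F|"
    using is_unbounded_number_unbounded_number unfolding is_unbounded_number_def by blast
  define up :: "(nat \<Rightarrow> nat) \<Rightarrow> nat \<Rightarrow> nat" where "up f n = Suc (n + (\<Sum>i\<le>n. f i))" for f n
  have up_ge: "f n \<le> up f n" for f n
    unfolding up_def using member_le_sum[of n "{..n}" f] by simp
  have "mono (up f)" for f
    unfolding up_def by (intro monoI) (simp add: add_le_mono sum_mono2)
  moreover have "n < up f n" for f n
    by (simp add: up_def)
  moreover have "unbounded_family (up ` F)"
    unfolding unbounded_family_def
  proof
    assume "\<exists>g. \<forall>h\<in>up ` F. le_Jbd h g"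
    then obtain g where "\<And>f. f \<in> F \<Longrightarrow> le_Jbd (up f) g"
      by blast
    then have "le_Jbd f g" if "f \<in> F" for f
      using that up_ge le_trans unfolding le_Jbd_def by metis
    with F(1) show False
      unfolding unbounded_family_def by blast
  qed
  moreover have "|up ` F| \<le>o \<bb>"
    unfolding F(2) by (rule card_of_image)
  ultimately show ?thesis
    by blast
qed

text \<open>The threshold \<open>N\<close> makes the condition insensitive to finite changes, as
  openness demands.\<close>

definition sparse :: "(nat \<Rightarrow> nat) \<Rightarrow> nat set set" where
  "sparse f = {U. infinite U \<and> (\<exists>N. \<forall>u\<in>U. \<forall>v\<in>U. N < u \<and> u < v \<longrightarrow> f u < v)}"

lemma dense_open_sparse:
  assumes f: "mono f"
  shows "dense_open (sparse f)"
proof (rule dense_openI)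
  fix U V
  assume U: "U \<in> sparse f" and V: "infinite V" "V \<subseteq>* U"
  obtain N where N: "\<And>u v. u \<in> U \<Longrightarrow> v \<in> U \<Longrightarrow> N < u \<Longrightarrow> u < v \<Longrightarrow> f u < v"
    using U unfolding sparse_def by blast
  obtain K where K: "\<And>x. x \<in> V - U \<Longrightarrow> x \<le> K"
    using V(2) unfolding almost_subset_def finite_nat_set_iff_bounded_le by blast
  have "f u < v" if "u \<in> V" "v \<in> V" "max N K < u" "u < v" for u v
  proof -
    have "u \<in> U" "v \<in> U"
      using that K[of u] K[of v] by auto
    with that show ?thesis
      using N by simp
  qed
  with V(1) show "V \<in> sparse f"
    unfolding sparse_def by blast
next
  fix R :: "nat set"
  assume R: "infinite R"
  have "\<exists>u. \<forall>n. u n \<in> R \<and> (u n < u (Suc n) \<and> f (u n) < u (Suc n))"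
  proof (rule dependent_nat_choice)
    show "\<exists>x. x \<in> R"
      using R infinite_imp_nonempty by blast
    fix x and n :: nat
    obtain y where "y \<in> R" "max x (f x) < y"
      using R unfolding infinite_nat_iff_unbounded by blast
    then show "\<exists>y. y \<in> R \<and> (x < y \<and> f x < y)"
      by auto
  qed
  then obtain u where u: "\<And>n. u n \<in> R" "\<And>n. u n < u (Suc n)" "\<And>n. f (u n) < u (Suc n)"
    by blast
  have u_mono: "strict_mono u"
    using u(2) by (simp add: strict_mono_Suc_iff)
  have inf: "infinite (range u)"
    using u_mono finite_imageD infinite_UNIV_nat strict_mono_imp_inj_on by blast
  have "f (u i) < u j" if "u i < u j" for i j
  proof -
    have "Suc i \<le> j"
      using that strict_mono_less[OF u_mono] by simp
    then have "u (Suc i) \<le> u j"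
      using strict_mono_less_eq[OF u_mono] by simp
    with u(3)[of i] show ?thesis by simp
  qed
  with inf have "range u \<in> sparse f"
    unfolding sparse_def by blast
  moreover have "range u \<subseteq> R"
    using u(1) by blast
  ultimately show "\<exists>U\<in>sparse f. U \<subseteq> R"
    by blast
qed (simp add: sparse_def)

text \<open>This yields \<open>\<hh> \<le> \<bb>\<close>. From a common member \<open>U\<close>,
  pick two elements \<open>u n < v n\<close> of \<open>U\<close> above \<open>n\<close>; sparseness
  gives \<open>f n \<le> f (u n) < v n\<close> for large \<open>n\<close>, so \<open>v\<close> would
  bound \<open>F\<close>.\<close>

lemma shattering_sparse:
  assumes F: "unbounded_family F" "\<And>f. f \<in> F \<Longrightarrow> mono f"
  shows "shattering (sparse ` F)"
  unfolding shattering_def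
proof
  show "\<forall>\<D>\<in>sparse ` F. dense_open \<D>"
    using dense_open_sparse F(2) by blast
  show "\<not> (\<exists>U. infinite U \<and> U \<in> \<Inter>(sparse ` F))"
  proof
    assume "\<exists>U. infinite U \<and> U \<in> \<Inter>(sparse ` F)"
    then obtain U where U: "infinite U" "\<And>f. f \<in> F \<Longrightarrow> U \<in> sparse f"
      by blast
    have "\<forall>n. \<exists>u v. u \<in> U \<and> v \<in> U \<and> n < u \<and> u < v"
      using U(1) unfolding infinite_nat_iff_unbounded by blast
    then obtain u v where uv: "\<And>n. u n \<in> U" "\<And>n. v n \<in> U" "\<And>n. n < u n" "\<And>n. u n < v n"
      by metis
    have "le_Jbd f v" if f: "f \<in> F" for f
    proof -
      obtain N where N: "\<And>x y. x \<in> U \<Longrightarrow> y \<in> U \<Longrightarrow> N < x \<Longrightarrow> x < y \<Longrightarrow> f x < y"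
        using U(2)[OF f] unfolding sparse_def by blast
      have "f n \<le> v n" if "n > N" for n
      proof -
        have "f n \<le> f (u n)"
          using F(2)[OF f] uv(3)[of n] by (simp add: monoD)
        also have "\<dots> < v n"
          using N[OF uv(1,2)] uv(3,4)[of n] that by simp
        finally show ?thesis by simp
      qed
      then show ?thesis
        unfolding le_Jbd_def by blast
    qed
    with F(1) show False
      unfolding unbounded_family_def by blast
  qed
qed

lemma minimal_shattering_exists:
  assumes "shattering \<EE>"
  shows "\<exists>\<DD>. minimal_shattering \<DD> \<and> |\<DD>| \<le>o |\<EE>|"
proof -
  let ?R = "{|\<DD>| | \<DD>. shattering \<DD>}"
  have "\<exists>r\<in>?R. \<forall>r'\<in>?R. r \<le>o r'"
    using assms card_of_Card_order by (intro exists_minim_Card_order) auto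
  then obtain \<DD> where "shattering \<DD>" "\<forall>r\<in>?R. |\<DD>| \<le>o r"
    by auto
  then have "minimal_shattering \<DD>"
    unfolding minimal_shattering_def by auto
  with assms show ?thesis
    unfolding minimal_shattering_def by auto
qed

section \<open>Interval partitions given by the iterates of a function\<close>

definition block :: "(nat \<Rightarrow> nat) \<Rightarrow> nat \<Rightarrow> nat set" where
  "block f k = {(f ^^ k) 0..<(f ^^ Suc k) 0}"

lemma strict_mono_funpow_zero: "strict_mono (\<lambda>k. (f ^^ k) 0)" if "\<And>n. n < f n" for f :: "nat \<Rightarrow> nat"
  using that by (simp add: strict_mono_Suc_iff)

lemma block_exists:
  assumes f: "\<And>n. n < f n"
  shows "\<exists>k. n \<in> block f k"
proof -
  define k where "k = (LEAST k. n < (f ^^ Suc k) 0)"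
  have "n < (f ^^ Suc n) 0"
    using strict_mono_imp_increasing[OF strict_mono_funpow_zero[of f], of "Suc n"] f by fastforce
  then have "n < (f ^^ Suc k) 0"
    unfolding k_def by (rule LeastI)
  moreover have "(f ^^ k) 0 \<le> n"
  proof (cases k)
    case (Suc i)
    then have "\<not> n < (f ^^ Suc i) 0"
      unfolding k_def by (intro not_less_Least) simp
    with Suc show ?thesis by simp
  qed simp
  ultimately show ?thesis
    unfolding block_def by auto
qed

lemma block_unique:
  assumes f: "\<And>n. n < f n" and n: "n \<in> block f k" "n \<in> block f l"
  shows "k = l"
proof -
  have "(f ^^ k) 0 < (f ^^ Suc l) 0" "(f ^^ l) 0 < (f ^^ Suc k) 0"
    using n unfolding block_def by (simp_all del: funpow.simps)
  then have "k < Suc l" "l < Suc k"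
    using strict_mono_less[OF strict_mono_funpow_zero[of f, OF f]] by blast+
  then show ?thesis
    by simp
qed

text \<open>If, for each \<open>f\<close>, only finitely many blocks contain an interval of
  \<open>m\<close>, then the ends of the intervals limit the growth of the late blocks, and two such
  estimates bound all of \<open>F\<close> by one function.\<close>

lemma unbounded_family_interval_in_block:
  assumes F: "unbounded_family F" "\<And>f. f \<in> F \<Longrightarrow> mono f" "\<And>f n. f \<in> F \<Longrightarrow> n < f n"
    and m: "strict_mono m"
  shows "\<exists>f\<in>F. infinite {k. \<exists>i. {m i..<m (Suc i)} \<subseteq> block f k}"
proof (rule ccontr)
  assume no: "\<not> ?thesis"
  define M where "M n = m (Suc n)" for n
  have M: "M a \<le> M b" if "a \<le> b" for a b
    unfolding M_def using strict_mono_less_eq[OF m] that by simp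
  have "le_Jbd f (\<lambda>n. M (M n))" if f: "f \<in> F" for f
  proof -
    let ?c = "\<lambda>k. (f ^^ k) 0"
    have c: "strict_mono ?c"
      using strict_mono_funpow_zero F(3)[OF f] by blast
    have "finite {k. \<exists>i. {m i..<m (Suc i)} \<subseteq> block f k}"
      using no f by blast
    then obtain l where l: "\<And>k i. {m i..<m (Suc i)} \<subseteq> block f k \<Longrightarrow> k < l"
      unfolding finite_nat_set_iff_bounded by blast
    have step: "?c (Suc k) \<le> M (?c k)" if "l \<le> k" for k
    proof (rule ccontr)
      assume "\<not> ?c (Suc k) \<le> M (?c k)"
      \<comment> \<open>The interval with index \<open>?c k\<close> starts no earlier than block
        \<open>k\<close>, so it lies in the block unless the block ends by
        \<open>M (?c k)\<close>.\<close>
      moreover have "?c k \<le> m (?c k)"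
        using m by (rule strict_mono_imp_increasing)
      ultimately have "{m (?c k)..<m (Suc (?c k))} \<subseteq> block f k"
        unfolding block_def M_def by auto
      then have "k < l"
        by (rule l)
      with that show False by simp
    qed
    have "f n \<le> M (M n)" if n: "n > ?c l" for n
    proof -
      obtain k where k: "n \<in> block f k"
        using block_exists[of f n] F(3)[OF f] by blast
      then have kn: "?c k \<le> n" "n < ?c (Suc k)"
        unfolding block_def by auto
      have "?c l < ?c (Suc k)"
        using n kn by simp
      then have "l < Suc k"
        using strict_mono_less[OF c] by blast
      then have lk: "l \<le> k"
        by simp
      have "f n \<le> f (?c (Suc k))"
        using F(2)[OF f] kn(2) by (simp add: monoD del: funpow.simps)
      also have "\<dots> = ?c (Suc (Suc k))"
        by simp
      also have "\<dots> \<le> M (?c (Suc k))"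
        using lk by (intro step) simp
      also have "\<dots> \<le> M (M (?c k))"
        by (intro M step lk)
      also have "\<dots> \<le> M (M n)"
        by (intro M kn)
      finally show ?thesis .
    qed
    then show ?thesis
      unfolding le_Jbd_def by blast
  qed
  with F(1) show False
    unfolding unbounded_family_def by blast
qed

section \<open>Groupwise dense families labelled by reals, and the bound\<close>

lemma groupwise_dense_reals:
  "\<exists>\<A> :: nat set \<Rightarrow> nat set set. (\<forall>x. groupwise_dense (\<A> x)) \<and>
    (\<forall>B. infinite B \<longrightarrow> |{x. \<exists>A\<in>\<A> x. B \<subseteq>* A}| \<le>o \<bb>)"
proof -
  obtain F where F: "unbounded_family F" "|F| \<le>o \<bb>" "\<And>f. f \<in> F \<Longrightarrow> mono f"
    "\<And>f n. f \<in> F \<Longrightarrow> n < f n"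
    using unbounded_number_attained by blast
  obtain \<DD> where DD: "minimal_shattering \<DD>" "|\<DD>| \<le>o |sparse ` F|"
    using minimal_shattering_exists[OF shattering_sparse[OF F(1,3)]] by blast
  let ?P = "\<lambda>N L. (\<forall>j\<in>\<DD>. almost_disjoint (N j)) \<and>
    (\<forall>R (x :: nat set). infinite R \<longrightarrow> (\<exists>j\<in>\<DD>. \<exists>T\<in>N j. infinite (T \<inter> R) \<and> L j T = x))"
  obtain N L where "?P N L"
    using labelled_base_matrix[OF DD(1)] by (elim exE)
  then have N: "\<And>j. j \<in> \<DD> \<Longrightarrow> almost_disjoint (N j)"
    and L: "\<And>R (x :: nat set). infinite R \<Longrightarrow> \<exists>j\<in>\<DD>. \<exists>T\<in>N j. infinite (T \<inter> R) \<and> L j T = x"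
    by simp_all
  define \<A> where "\<A> x = {A. infinite A \<and>
    (\<exists>f\<in>F. \<exists>j\<in>\<DD>. \<exists>T\<in>N j. L j T = x \<and> A \<subseteq> (\<Union>k\<in>T. block f k))}" for x
  have "groupwise_dense (\<A> x)" for x
    unfolding groupwise_dense_def
  proof (intro conjI allI impI)
    fix m :: "nat \<Rightarrow> nat"
    assume m: "strict_mono m"
    obtain f where f: "f \<in> F" "infinite {k. \<exists>i. {m i..<m (Suc i)} \<subseteq> block f k}"
      using unbounded_family_interval_in_block[of F m] F(1,3,4) m by blast
    define R where "R = {k. \<exists>i. {m i..<m (Suc i)} \<subseteq> block f k}"
    obtain j T where jT: "j \<in> \<DD>" "T \<in> N j" "infinite (T \<inter> R)" "L j T = x"
      using L[OF f(2)] unfolding R_def by blast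
    \<comment> \<open>Label \<open>x\<close> is realised by thinning out the blocks to those with
      index in \<open>T\<close>, keeping only the intervals inside them.\<close>
    define U where "U = {i. \<exists>k\<in>T. {m i..<m (Suc i)} \<subseteq> block f k}"
    have mi: "m i < m (Suc i)" for i
      using strict_monoD[OF m lessI] .
    have inf: "infinite U"
    proof
      assume "finite U"
      \<comment> \<open>Each \<open>k\<close> in \<open>T \<inter> R\<close> is the index of the
        block containing some \<open>m i\<close> with \<open>i\<close> in \<open>U\<close>, so a
        finite \<open>U\<close> would make \<open>T \<inter> R\<close> finite.\<close>
      define blk where "blk n = (THE k. n \<in> block f k)" for n
      have "T \<inter> R \<subseteq> (\<lambda>i. blk (m i)) ` U"
      proof
        fix k
        assume k: "k \<in> T \<inter> R"
        then obtain i where i: "{m i..<m (Suc i)} \<subseteq> block f k"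
          unfolding R_def by blast
        then have "m i \<in> block f k"
          using mi[of i] by (meson atLeastLessThan_iff order_refl subsetD)
        then have "blk (m i) = k"
          unfolding blk_def using block_unique[of f] F(4)[OF f(1)] by blast
        moreover have "i \<in> U"
          unfolding U_def using i k by blast
        ultimately show "k \<in> (\<lambda>i. blk (m i)) ` U"
          by blast
      qed
      with \<open>finite U\<close> jT(3) show False
        by (meson finite_imageI finite_subset)
    qed
    have "m ` U \<subseteq> (\<Union>i\<in>U. {m i..<m (Suc i)})"
      using mi by force
    moreover have "infinite (m ` U)"
      using inf strict_mono_imp_inj_on[OF m] by (meson finite_imageD inj_on_subset subset_UNIV)
    ultimately have "infinite (\<Union>i\<in>U. {m i..<m (Suc i)})"
      using finite_subset by blast
    moreover have "(\<Union>i\<in>U. {m i..<m (Suc i)}) \<subseteq> (\<Union>k\<in>T. block f k)"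
      unfolding U_def by blast
    ultimately have "(\<Union>i\<in>U. {m i..<m (Suc i)}) \<in> \<A> x"
      unfolding \<A>_def using f(1) jT(1,2,4) by blast
    with inf show "\<exists>U. infinite U \<and> (\<Union>i\<in>U. {m i..<m (Suc i)}) \<in> \<A> x"
      by blast
  next
    fix A B
    assume "A \<in> \<A> x \<and> B \<subseteq> A \<and> infinite B"
    then show "B \<in> \<A> x"
      unfolding \<A>_def using subset_trans[of B A] by blast
  qed (simp add: \<A>_def subset_iff)
  moreover have "|{x. \<exists>A\<in>\<A> x. B \<subseteq>* A}| \<le>o \<bb>" if B: "infinite B" for B
  proof -
    define X where "X = {x. \<exists>A\<in>\<A> x. B \<subseteq>* A}"
    have "\<exists>f j T. f \<in> F \<and> j \<in> \<DD> \<and> T \<in> N j \<and> L j T = x \<and> B \<subseteq>* (\<Union>k\<in>T. block f k)"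
      if x: "x \<in> X" for x
    proof -
      obtain A where A: "A \<in> \<A> x" "B \<subseteq>* A"
        using x unfolding X_def by blast
      then obtain f j T where "f \<in> F" "j \<in> \<DD>" "T \<in> N j" "L j T = x" "A \<subseteq> (\<Union>k\<in>T. block f k)"
        unfolding \<A>_def by blast
      then show ?thesis
        using almost_subset_trans[OF A(2) almost_subset_subset] by blast
    qed
    then obtain f j T where fjT: "\<And>x. x \<in> X \<Longrightarrow> f x \<in> F" "\<And>x. x \<in> X \<Longrightarrow> j x \<in> \<DD>"
      "\<And>x. x \<in> X \<Longrightarrow> T x \<in> N (j x)" "\<And>x. x \<in> X \<Longrightarrow> L (j x) (T x) = x"
      "\<And>x. x \<in> X \<Longrightarrow> B \<subseteq>* (\<Union>k\<in>T x. block (f x) k)"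
      by metis
    \<comment> \<open>With the same \<open>f\<close> and \<open>j\<close>, both unions almost
      contain \<open>B\<close>. Blocks are disjoint and finite, so \<open>T x\<close> and
      \<open>T y\<close> share infinitely many indices and coincide by almost disjointness; the
      label then returns \<open>x = y\<close>.\<close>
    have "inj_on (\<lambda>x. (f x, j x)) X"
    proof (rule inj_onI)
      fix x y
      assume x: "x \<in> X" and y: "y \<in> X" and eq: "(f x, j x) = (f y, j y)"
      let ?S = "\<lambda>x. \<Union>k\<in>T x. block (f x) k"
      have f_less: "n < f x n" for n
        using F(4)[OF fjT(1)[OF x]] .
      have "infinite (?S x \<inter> ?S y)"
        using infinite_Int_mono[of B B, OF _ fjT(5)[OF x] fjT(5)[OF y]] B by simp
      moreover have "?S x \<inter> ?S y \<subseteq> (\<Union>k\<in>T x \<inter> T y. block (f x) k)"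
        using block_unique[of "f x", OF f_less] eq by auto
      ultimately have "infinite (\<Union>k\<in>T x \<inter> T y. block (f x) k)"
        using finite_subset by blast
      then have "infinite (T x \<inter> T y)"
        by (auto simp: block_def)
      then have T_eq: "T x = T y"
        using almost_disjointD[OF N[OF fjT(2)[OF x]] fjT(3)[OF x], of "T y"] fjT(3)[OF y] eq by simp
      have "x = L (j x) (T x)"
        using fjT(4)[OF x] by (rule sym)
      also have "\<dots> = L (j y) (T y)"
        using T_eq eq by (simp only: prod.inject)
      also have "\<dots> = y"
        by (rule fjT(4)[OF y])
      finally show "x = y" .
    qed
    moreover have "(\<lambda>x. (f x, j x)) ` X \<subseteq> F \<times> \<DD>"
      using fjT(1,2) by blast
    ultimately have "|X| \<le>o |F \<times> \<DD>|"
      unfolding card_of_ordLeq[symmetric] by (intro exI conjI)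
    \<comment> \<open>\<open>\<DD>\<close> is no larger than \<open>sparse\<close> applied to
      \<open>F\<close>, and the infinite set \<open>F\<close> absorbs it.\<close>
    also have "|F \<times> \<DD>| \<le>o |F|"
    proof (rule card_of_Times_ordLeq_infinite_Field)
      show "infinite (Field |F| )"
        using infinite_unbounded_family[OF F(1)] by (simp add: Field_card_of)
      show "|\<DD>| \<le>o |F|"
        using DD(2) card_of_image by (rule ordLeq_transitive)
    qed (rule card_of_mono1[OF order_refl] card_of_Card_order)+
    also note F(2)
    finally show ?thesis
      unfolding X_def .
  qed
  ultimately show ?thesis
    by (intro exI[of _ \<A>] conjI allI impI)
qed

theorem theorem2p2:
  shows "\<gg> \<le>o cardSuc \<bb>"
proof -
  obtain F :: "(nat \<Rightarrow> nat) set" where "\<bb> = |F|"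
    using is_unbounded_number_unbounded_number unfolding is_unbounded_number_def by blast
  then have co: "Card_order \<bb>"
    using card_of_Card_order[of F] by (rule ssubst)
  note cos = cardSuc_Card_order[OF co]
  consider "|UNIV :: nat set set| \<le>o cardSuc \<bb>" | "cardSuc \<bb> \<le>o |UNIV :: nat set set|"
    using ordLeq_total card_of_Well_order cardSuc_Well_order[OF co] by blast
  then show ?thesis
  proof cases
    case 1
    have "\<gg> \<le>o |UNIV :: nat set set|"
      using groupwise_density_witness_exists groupwise_density_number_le card_of_Card_order by blast
    then show ?thesis
      using 1 by (rule ordLeq_transitive)
  next
    case 2
    have "|Field (cardSuc \<bb>)| \<le>o |UNIV :: nat set set|"
      using card_of_Field_ordIso[OF cos] 2 by (rule ordIso_ordLeq_trans)
    then obtain e :: "_ \<Rightarrow> nat set" where e: "inj_on e (Field (cardSuc \<bb>))"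
      unfolding card_of_ordLeq[symmetric] by blast
    obtain \<A> :: "nat set \<Rightarrow> nat set set" where A: "\<forall>x. groupwise_dense (\<A> x)"
      "\<forall>B. infinite B \<longrightarrow> |{x. \<exists>A\<in>\<A> x. B \<subseteq>* A}| \<le>o \<bb>"
      using groupwise_dense_reals by (elim exE conjE)
    have "\<exists>\<alpha>\<in>Field (cardSuc \<bb>). \<forall>A\<in>\<A> (e \<alpha>). \<not> B \<subseteq>* A" if B: "infinite B" for B
    proof (rule ccontr)
      assume "\<not> ?thesis"
      \<comment> \<open>A bad \<open>B\<close> would be almost covered for every chosen label. As
        \<open>e\<close> is injective, these are \<open>\<bb>\<^sup>+\<close> many, against the
        bound \<open>\<bb>\<close>.\<close>
      then have "e ` Field (cardSuc \<bb>) \<subseteq> {x. \<exists>A\<in>\<A> x. B \<subseteq>* A}"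
        by blast
      with e have "|Field (cardSuc \<bb>)| \<le>o |{x. \<exists>A\<in>\<A> x. B \<subseteq>* A}|"
        unfolding card_of_ordLeq[symmetric] by blast
      then have "|Field (cardSuc \<bb>)| \<le>o \<bb>"
        using A(2)[rule_format, OF B] by (rule ordLeq_transitive)
      then have "cardSuc \<bb> \<le>o \<bb>"
        using card_of_Field_ordIso[OF cos] ordIso_symmetric ordIso_ordLeq_trans by blast
      then show False
        using cardSuc_greater[OF co] not_ordLess_ordLeq by blast
    qed
    then have "groupwise_density_witness (cardSuc \<bb>) (\<lambda>\<alpha>. \<A> (e \<alpha>))"
      unfolding groupwise_density_witness_def using A(1) by blast
    then show ?thesis
      by (rule groupwise_density_number_le[OF cos])
  qed
qed

end
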